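(* Given an $n$-vertex graph $G$, one can in polynomial time construct a family $\mathcal{F}_0$ of subsets of $V(G)$ of size at most $n^2$ such that every primitive separator of $G$ belongs to $\mathcal{F}_0$.
   Context: For $X \subseteq V(G)$, $N(X)$ denotes the set of vertices outside $X$ with a neighbor in $X$. A set $S \subseteq V(G)$ is a minimal separator of $G$ if $G - S$ has at least two connected components $D$ with $N(D) = S$ (such components are called full components of $S$). A minimal separator $S$ is primitive if $S \subseteq N(v)$ for some vertex $v \in V(G)$. *)

theory Defs
  imports "Graph_Theory.Graph_Theory" "HOL-Computational_Algebra.Polynomial"
begin

section \<open>Separators\<close>

text \<open>
  Finite simple undirected graphs are the \<^locale>\<open>graph\<close>s of the library, i.e. finite symmetric
  digraphs without loops and parallel arcs.
\<close>

definition neighborhood :: "('a,'b) pre_digraph \<Rightarrow> 'a set \<Rightarrow> 'a set" where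
  "neighborhood G X = {v \<in> verts G - X. \<exists>u \<in> X. u \<rightarrow>\<^bsub>G\<^esub> v}"

definition components :: "('a,'b) pre_digraph \<Rightarrow> 'a set set" where
  "components G = verts ` {H. pre_digraph.max_subgraph G Digraph_Component.connected H}"

definition full_components :: "('a,'b) pre_digraph \<Rightarrow> 'a set \<Rightarrow> 'a set set" where
  "full_components G S = {D \<in> components (G \<restriction> (verts G - S)). neighborhood G D = S}"

definition minimal_separator :: "('a,'b) pre_digraph \<Rightarrow> 'a set \<Rightarrow> bool" where
  "minimal_separator G S \<longleftrightarrow> S \<subseteq> verts G \<and>
     (\<exists>D \<in> full_components G S. \<exists>D' \<in> full_components G S. D \<noteq> D')"

definition primitive_separator :: "('a,'b) pre_digraph \<Rightarrow> 'a set \<Rightarrow> bool" where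
  "primitive_separator G S \<longleftrightarrow>
     minimal_separator G S \<and> (\<exists>v \<in> verts G. S \<subseteq> neighborhood G {v})"


section \<open>Machine model\<close>

text \<open>
  A random access machine, programmed in a while-language. Its store consists of arrays of natural
  numbers with computed indices; a scalar variable is cell 0 of an array. Every operation costs one
  unit. As the only arithmetic operations are addition and truncated subtraction, the numbers grow
  by at most one bit per unit of time, hence polynomial time in this model is polynomial time on
  Turing machines. (This would fail for multiplication at unit cost.)
\<close>

type_synonym store = "string \<Rightarrow> nat \<Rightarrow> nat"

datatype expr =
    Num nat
  | Read string expr
  | Add expr expr
  | Sub expr expr

fun val :: "expr \<Rightarrow> store \<Rightarrow> nat" where
  "val (Num k) s = k"
| "val (Read x a) s = s x (val a s)"
| "val (Add a b) s = val a s + val b s"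
| "val (Sub a b) s = val a s - val b s"

fun cost :: "expr \<Rightarrow> nat" where
  "cost (Num k) = 1"
| "cost (Read x a) = 1 + cost a"
| "cost (Add a b) = 1 + cost a + cost b"
| "cost (Sub a b) = 1 + cost a + cost b"

datatype prog =
    Skip
  | Write string expr expr
  | Then prog prog
  | Cond expr prog prog
  | Loop expr prog

text \<open>
  \<open>exec p s t s'\<close>: started in store \<open>s\<close>, the program \<open>p\<close> halts after exactly \<open>t\<close> units of time in
  store \<open>s'\<close>. A test succeeds iff the expression is nonzero.
\<close>

inductive exec :: "prog \<Rightarrow> store \<Rightarrow> nat \<Rightarrow> store \<Rightarrow> bool" where
  Skip: "exec Skip s 1 s"
| Write: "exec (Write x a b) s (1 + cost a + cost b) (s(x := (s x)(val a s := val b s)))"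
| Then: "exec p s t s' \<Longrightarrow> exec q s' t' s'' \<Longrightarrow> exec (Then p q) s (1 + t + t') s''"
| Cond_True: "val a s \<noteq> 0 \<Longrightarrow> exec p s t s' \<Longrightarrow> exec (Cond a p q) s (1 + cost a + t) s'"
| Cond_False: "val a s = 0 \<Longrightarrow> exec q s t s' \<Longrightarrow> exec (Cond a p q) s (1 + cost a + t) s'"
| Loop_True: "val a s \<noteq> 0 \<Longrightarrow> exec p s t s' \<Longrightarrow> exec (Loop a p) s' t' s'' \<Longrightarrow>
    exec (Loop a p) s (1 + cost a + t + t') s''"
| Loop_False: "val a s = 0 \<Longrightarrow> exec (Loop a p) s (1 + cost a) s"

inductive_cases exec_SkipE: "exec Skip s t s'"
inductive_cases exec_WriteE: "exec (Write x a b) s t s'"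
inductive_cases exec_ThenE: "exec (Then p q) s t s'"
inductive_cases exec_CondE: "exec (Cond a p q) s t s'"
inductive_cases exec_LoopE: "exec (Loop a p) s t s'"

lemma exec_deterministic:
  "exec p s t s' \<Longrightarrow> exec p s u s'' \<Longrightarrow> u = t \<and> s'' = s'"
proof (induction arbitrary: u s'' rule: exec.induct)
  case (Skip s)
  then show ?case by (rule exec_SkipE) simp
next
  case (Write x a b s)
  then show ?case by (rule exec_WriteE) simp
next
  case (Then p s t s1 q t' s2)
  from Then.prems show ?case
    by (rule exec_ThenE) (auto dest!: Then.IH)
next
  case (Cond_True a s p t s' q)
  from Cond_True.prems show ?case
    by (rule exec_CondE) (use Cond_True.hyps(1) in \<open>auto dest!: Cond_True.IH\<close>)+
next
  case (Cond_False a s q t s' p)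
  from Cond_False.prems show ?case
    by (rule exec_CondE) (use Cond_False.hyps(1) in \<open>auto dest!: Cond_False.IH\<close>)+
next
  case (Loop_True a s p t s1 t' s2)
  from Loop_True.prems show ?case
    by (rule exec_LoopE) (use Loop_True.hyps(1) in \<open>auto dest!: Loop_True.IH\<close>)+
next
  case (Loop_False a s p)
  from Loop_False.prems show ?case
    by (rule exec_LoopE) (use Loop_False.hyps in auto)+
qed


section \<open>Encoding of graphs and families\<close>

text \<open>
  The list \<open>vs\<close> enumerates the vertices. The input is the number of vertices together with the
  adjacency matrix, row by row; all other cells are zero.
\<close>

definition graph_input :: "('a,'b) pre_digraph \<Rightarrow> 'a list \<Rightarrow> store" where
  "graph_input G vs = (\<lambda>x k. let n = length vs in
     if x = ''n'' \<and> k = 0 then n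
     else if x = ''adj'' \<and> k < n * n \<and> vs ! (k div n) \<rightarrow>\<^bsub>G\<^esub> vs ! (k mod n) then 1
     else 0)"

text \<open>
  The output is the number of sets listed, together with their characteristic vectors, one after the
  other.
\<close>

definition output_family :: "'a list \<Rightarrow> store \<Rightarrow> 'a set set" where
  "output_family vs s = (let n = length vs in
     {{vs ! i | i. i < n \<and> s ''fam'' (j * n + i) \<noteq> 0} | j. j < s ''cnt'' 0})"

end

theory Submission
  imports Defs
begin

text \<open>
  Let \<open>S\<close> be a minimal separator with \<open>S \<subseteq> N(v)\<close>. One of its full components, say \<open>D\<close>, does not
  contain \<open>v\<close>. As \<open>v \<notin> S = N(D)\<close>, no vertex of \<open>D\<close> is adjacent to \<open>v\<close>; as \<open>N(D) \<subseteq> N(v)\<close>, the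
  set \<open>D\<close> is therefore a component of \<open>G - N[v]\<close>. Hence \<open>S\<close> is the neighborhood of the component of
  \<open>u\<close> in \<open>G - N[v]\<close> for some pair \<open>(v, u)\<close>, and there are only \<open>n\<^sup>2\<close> pairs. The program computes each
  of these components by \<open>n\<close> rounds of propagating marks along all edges.
\<close>

section \<open>Reasoning about programs\<close>

fun writes :: "prog \<Rightarrow> string set" where
  "writes Skip = {}"
| "writes (Write x a b) = {x}"
| "writes (Then p q) = writes p \<union> writes q"
| "writes (Cond a p q) = writes p \<union> writes q"
| "writes (Loop a p) = writes p"

lemma exec_unchanged: "exec p s t s' \<Longrightarrow> y \<notin> writes p \<Longrightarrow> s' y = s y"
  by (induction rule: exec.induct) auto

text \<open>Total correctness with an upper bound on the time. A bound instead of the exact cost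
  lets branches of different cost share one \<open>T\<close>.\<close>

definition runs :: "prog \<Rightarrow> store \<Rightarrow> nat \<Rightarrow> (store \<Rightarrow> bool) \<Rightarrow> bool" where
  "runs p s T Q \<longleftrightarrow> (\<exists>t s'. exec p s t s' \<and> t \<le> T \<and> Q s')"

lemma runs_Skip: "Q s \<Longrightarrow> 1 \<le> T \<Longrightarrow> runs Skip s T Q"
  unfolding runs_def using exec.Skip by blast

lemma runs_Write:
  "Q (s(x := (s x)(val a s := val b s))) \<Longrightarrow> 1 + cost a + cost b \<le> T \<Longrightarrow> runs (Write x a b) s T Q"
  unfolding runs_def using exec.Write by blast

text \<open>The frame condition is handed to the second program, so an intermediate assertion need
  only mention arrays that the first program writes.\<close>

lemma runs_Then:
  assumes "runs p s T P"
    and "\<And>s'. P s' \<Longrightarrow> (\<And>y. y \<notin> writes p \<Longrightarrow> s' y = s y) \<Longrightarrow> runs q s' U Q"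
  shows "runs (Then p q) s (1 + T + U) Q"
proof -
  obtain t s' where s': "exec p s t s'" "t \<le> T" "P s'"
    using assms(1) unfolding runs_def by blast
  obtain t' s'' where s'': "exec q s' t' s''" "t' \<le> U" "Q s''"
    using assms(2)[OF s'(3) exec_unchanged[OF s'(1)]] unfolding runs_def by blast
  have "exec (Then p q) s (1 + t + t') s''"
    by (rule exec.Then[OF s'(1) s''(1)])
  moreover have "1 + t + t' \<le> 1 + T + U" using s'(2) s''(2) by simp
  ultimately show ?thesis using s''(3) unfolding runs_def by blast
qed

lemma runs_Cond:
  assumes "val a s \<noteq> 0 \<Longrightarrow> runs p s T Q" and "val a s = 0 \<Longrightarrow> runs q s T Q"
  shows "runs (Cond a p q) s (1 + cost a + T) Q"
proof (cases "val a s = 0")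
  case True
  then obtain t s' where "exec q s t s'" "t \<le> T" "Q s'"
    using assms(2) unfolding runs_def by blast
  with exec.Cond_False[OF True this(1), of p] show ?thesis
    unfolding runs_def by (meson add_left_mono)
next
  case False
  then obtain t s' where "exec p s t s'" "t \<le> T" "Q s'"
    using assms(1) unfolding runs_def by blast
  with exec.Cond_True[OF False this(1), of q] show ?thesis
    unfolding runs_def by (meson add_left_mono)
qed

lemma runs_mono:
  assumes "runs p s T P" and "T \<le> U"
    and "\<And>s'. P s' \<Longrightarrow> (\<And>y. y \<notin> writes p \<Longrightarrow> s' y = s y) \<Longrightarrow> Q s'"
  shows "runs p s U Q"
  using assms exec_unchanged unfolding runs_def by (meson le_trans)

section \<open>Counting loops\<close>

abbreviation Var :: "string \<Rightarrow> expr" where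
  "Var x \<equiv> Read x (Num 0)"

text \<open>Subtraction is truncated, so the test is nonzero exactly while the counter is below cell
  0 of \<open>n\<close>.\<close>

definition For :: "string \<Rightarrow> prog \<Rightarrow> prog" where
  "For x p = Then (Write x (Num 0) (Num 0))
     (Loop (Sub (Var ''n'') (Var x)) (Then p (Write x (Num 0) (Add (Var x) (Num 1)))))"

lemma writes_For [simp]: "writes (For x p) = insert x (writes p)"
  by (auto simp: For_def)

text \<open>Induction on the number \<open>m\<close> of iterations left. By \<open>indep\<close> the
  invariant survives the increment of the counter; \<open>s0\<close> is a fixed store to which the
  frame condition of every iteration refers. The failing test costs 6; an iteration adds to its body
  6 for the test, 1 for \<open>Then\<close> and 6 for the increment.\<close>

lemma runs_Loop_up:
  assumes "x \<notin> writes p" "''n'' \<notin> writes p" "x \<noteq> ''n''"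
    and body: "\<And>k s. k < N \<Longrightarrow> I k s \<Longrightarrow> s x 0 = k \<Longrightarrow> s ''n'' 0 = N \<Longrightarrow>
      (\<And>y. y \<notin> writes p \<Longrightarrow> y \<noteq> x \<Longrightarrow> s y = s0 y) \<Longrightarrow> runs p s T (I (Suc k))"
    and indep: "\<And>k s f. I k s \<Longrightarrow> I k (s(x := f))"
    and "s x 0 + m = N" "I (s x 0) s" "s ''n'' 0 = N"
    and "\<And>y. y \<notin> writes p \<Longrightarrow> y \<noteq> x \<Longrightarrow> s y = s0 y"
  shows "runs (Loop (Sub (Var ''n'') (Var x)) (Then p (Write x (Num 0) (Add (Var x) (Num 1)))))
    s (6 + m * (T + 13)) (I N)"
    (is "runs (Loop ?a ?p) _ _ _")
  using assms(6-)
proof (induction m arbitrary: s)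
  case 0
  have "exec (Loop ?a ?p) s (1 + cost ?a) s"
    by (rule exec.Loop_False) (use 0 in simp)
  then show ?case using 0 unfolding runs_def by fastforce
next
  case (Suc m)
  have "runs p s T (I (Suc (s x 0)))"
    using Suc.prems by (intro body) auto
  then obtain t s1 where s1: "exec p s t s1" "t \<le> T" "I (Suc (s x 0)) s1"
    unfolding runs_def by blast
  have frame: "s1 y = s y" if "y \<notin> writes p" for y
    using exec_unchanged[OF s1(1) that] .
  define s2 where "s2 = s1(x := (s1 x)(0 := Suc (s x 0)))"
  have "exec (Write x (Num 0) (Add (Var x) (Num 1))) s1 6 s2"
    using exec.Write[of x "Num 0" "Add (Var x) (Num 1)" s1] frame[OF assms(1)]
    by (simp add: s2_def eval_nat_numeral)
  then have body2: "exec ?p s (1 + t + 6) s2"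
    using exec.Then s1(1) by blast
  have "runs (Loop ?a ?p) s2 (6 + m * (T + 13)) (I N)"
  proof (rule Suc.IH)
    show "s2 x 0 + m = N" using Suc.prems(1) by (simp add: s2_def)
    show "I (s2 x 0) s2" using indep[OF s1(3)] by (simp add: s2_def)
    show "s2 ''n'' 0 = N" using Suc.prems(3) frame[OF assms(2)] assms(3) by (simp add: s2_def)
    show "s2 y = s0 y" if "y \<notin> writes p" "y \<noteq> x" for y
      using Suc.prems(4)[OF that] frame[OF that(1)] that(2) by (simp add: s2_def)
  qed
  then obtain t' s' where s': "exec (Loop ?a ?p) s2 t' s'" "t' \<le> 6 + m * (T + 13)" "I N s'"
    unfolding runs_def by blast
  have "exec (Loop ?a ?p) s (1 + cost ?a + (1 + t + 6) + t') s'"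
    by (rule exec.Loop_True[OF _ body2 s'(1)]) (use Suc.prems in simp)
  moreover have "1 + cost ?a + (1 + t + 6) + t' \<le> 6 + Suc m * (T + 13)"
    using s1(2) s'(2) by simp
  ultimately show ?case using s'(3) unfolding runs_def by blast
qed

text \<open>
  Polymorphic, so that time bounds can be instantiated both with numbers and, at the indeterminate,
  with polynomials.
\<close>

definition for_time :: "'c::comm_semiring_1 \<Rightarrow> 'c \<Rightarrow> 'c" where
  "for_time n t = 10 + n * (t + 13)"

lemma runs_For:
  assumes "s ''n'' 0 = N" "I 0 s"
    and "\<And>k s'. k < N \<Longrightarrow> I k s' \<Longrightarrow> s' x 0 = k \<Longrightarrow> s' ''n'' 0 = N \<Longrightarrow>
      (\<And>y. y \<notin> writes p \<Longrightarrow> y \<noteq> x \<Longrightarrow> s' y = s y) \<Longrightarrow> runs p s' T (I (Suc k))"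
    and "x \<notin> writes p" "''n'' \<notin> writes p" "x \<noteq> ''n''"
    and indep: "\<And>k s f. I k s \<Longrightarrow> I k (s(x := f))"
  shows "runs (For x p) s (for_time N T) (I N)"
proof -
  let ?s = "s(x := (s x)(0 := 0))"
  let ?L = "Loop (Sub (Var ''n'') (Var x)) (Then p (Write x (Num 0) (Add (Var x) (Num 1))))"
  have "runs ?L ?s (6 + N * (T + 13)) (I N)"
    by (rule runs_Loop_up[where ?s0.0 = s and I = I, OF assms(4-6) assms(3) indep])
       (use assms(1,6) indep[OF assms(2)] in simp_all)
  \<comment> \<open>1 for \<open>Then\<close> and 3 for resetting the counter; with the 6 of the
    failing test this gives the 10 in \<open>for_time\<close>.\<close>
  then have "runs (For x p) s (1 + 3 + (6 + N * (T + 13))) (I N)"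
    unfolding For_def by (intro runs_Then[where P = "\<lambda>s'. s' = ?s"] runs_Write) auto
  then show ?thesis by (simp add: for_time_def)
qed

section \<open>Components avoiding a closed neighborhood\<close>

text \<open>The closed neighborhood N[v].\<close>

definition blocked :: "(nat \<Rightarrow> nat \<Rightarrow> bool) \<Rightarrow> nat \<Rightarrow> nat set" where
  "blocked E v = insert v {j. E v j}"

text \<open>Testing only the head suffices: a path that starts outside N[v] then never enters
  it.\<close>

definition steps :: "(nat \<Rightarrow> nat \<Rightarrow> bool) \<Rightarrow> nat \<Rightarrow> (nat \<times> nat) set" where
  "steps E v = {(i, j). E i j \<and> j \<notin> blocked E v}"

text \<open>For symmetric \<open>E\<close>, the component of \<open>u\<close> in G - N[v]; the empty
  set is the default for \<open>u\<close> in N[v].\<close>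

definition comp_avoiding :: "(nat \<Rightarrow> nat \<Rightarrow> bool) \<Rightarrow> nat \<Rightarrow> nat \<Rightarrow> nat set" where
  "comp_avoiding E v u = (if u \<in> blocked E v then {} else (steps E v)\<^sup>* `` {u})"

definition boundary :: "(nat \<Rightarrow> nat \<Rightarrow> bool) \<Rightarrow> nat set \<Rightarrow> nat set" where
  "boundary E D = {j. j \<notin> D \<and> (\<exists>i\<in>D. E i j)}"

text \<open>There is no multiplication, so the row offsets \<open>i * n\<close> are tabulated in \<open>off\<close>.\<close>

definition matrix_store :: "nat \<Rightarrow> (nat \<Rightarrow> nat \<Rightarrow> bool) \<Rightarrow> store \<Rightarrow> bool" where
  "matrix_store n E s \<longleftrightarrow> s ''n'' 0 = n \<and> (\<forall>i<n. s ''off'' i = i * n) \<and>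
     (\<forall>i<n. \<forall>j<n. s ''adj'' (i * n + j) \<noteq> 0 \<longleftrightarrow> E i j)"

definition marked :: "nat \<Rightarrow> string \<Rightarrow> store \<Rightarrow> nat set" where
  "marked n x s = {j. j < n \<and> s x j \<noteq> 0}"

lemma marked_upd_other [simp]: "x \<noteq> y \<Longrightarrow> marked n x (s(y := f)) = marked n x s"
  by (simp add: marked_def)

definition edge :: "string \<Rightarrow> string \<Rightarrow> expr" where
  "edge x y = Read ''adj'' (Add (Read ''off'' (Var x)) (Var y))"

lemma cost_edge [simp]: "cost (edge x y) = 7"
  by (simp add: edge_def)

lemma val_edge:
  "matrix_store n E s \<Longrightarrow> s x 0 < n \<Longrightarrow> s y 0 < n \<Longrightarrow> val (edge x y) s \<noteq> 0 \<longleftrightarrow> E (s x 0) (s y 0)"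
  by (simp add: edge_def matrix_store_def)

section \<open>Row offsets and the marks of a closed neighborhood\<close>

definition offsets_prog :: prog where
  "offsets_prog = For ''i''
     (Write ''off'' (Add (Var ''i'') (Num 1)) (Add (Read ''off'' (Var ''i'')) (Var ''n'')))"

text \<open>Repeated addition of \<open>n\<close> replaces multiplication, starting from the zero in
  cell 0. Iteration \<open>k\<close> writes entry \<open>k + 1\<close>, so the invariant includes
  entry \<open>k\<close>.\<close>

lemma runs_offsets:
  assumes "s ''n'' 0 = n" "s ''off'' 0 = 0"
  shows "runs offsets_prog s (for_time n 11) (\<lambda>s'. \<forall>i\<le>n. s' ''off'' i = i * n)"
  unfolding offsets_prog_def
proof (rule runs_For[where I = "\<lambda>k s. \<forall>i\<le>k. s ''off'' i = i * n"], goal_cases)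
  case (3 k s')
  then show ?case by (intro runs_Write) (simp_all add: le_Suc_eq)
qed (use assms in simp_all)

text \<open>The cell of \<open>v\<close> is set after the copying loop, which would otherwise
  overwrite it.\<close>

definition block_prog :: prog where
  "block_prog = Then (For ''i'' (Write ''B'' (Var ''i'') (edge ''v'' ''i'')))
     (Write ''B'' (Var ''v'') (Num 1))"

lemma runs_block:
  assumes "matrix_store n E s" "s ''v'' 0 = v" "v < n" "\<And>i j. E i j \<Longrightarrow> j < n"
  shows "runs block_prog s (1 + for_time n 10 + 4)
    (\<lambda>s'. marked n ''B'' s' = blocked E v)"
  unfolding block_prog_def
proof (rule runs_Then)
  show "runs (For ''i'' (Write ''B'' (Var ''i'') (edge ''v'' ''i''))) s (for_time n 10)
    (\<lambda>s'. \<forall>i<n. s' ''B'' i \<noteq> 0 \<longleftrightarrow> E v i)"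
  proof (rule runs_For[where I = "\<lambda>k s. \<forall>i<k. s ''B'' i \<noteq> 0 \<longleftrightarrow> E v i"], goal_cases)
    case (3 k s')
    have "matrix_store n E s'" using assms(1) 3(5) by (simp add: matrix_store_def)
    then have "val (edge ''v'' ''i'') s' \<noteq> 0 \<longleftrightarrow> E v k"
      using val_edge[of n E s' "''v''" "''i''"] 3 assms(2,3) by simp
    then show ?case using 3(2,3) by (auto intro!: runs_Write simp: less_Suc_eq)
  qed (use assms(1) in \<open>auto simp: matrix_store_def\<close>)
  fix s1
  assume B: "\<forall>i<n. s1 ''B'' i \<noteq> 0 \<longleftrightarrow> E v i"
    and "\<And>y. y \<notin> writes (For ''i'' (Write ''B'' (Var ''i'') (edge ''v'' ''i''))) \<Longrightarrow> s1 y = s y"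
  then have "s1 ''v'' 0 = v" using assms(2) by simp
  with B show "runs (Write ''B'' (Var ''v'') (Num 1)) s1 4 (\<lambda>s'. marked n ''B'' s' = blocked E v)"
    using assms(3,4) by (intro runs_Write) (auto simp: marked_def blocked_def)
qed

section \<open>Propagation of marks up to closure\<close>

definition round_prog :: prog where
  "round_prog = For ''i'' (For ''j''
     (Cond (Read ''R'' (Var ''i''))
       (Cond (edge ''i'' ''j'')
         (Cond (Read ''B'' (Var ''j'')) Skip (Write ''R'' (Var ''j'') (Num 1)))
         Skip)
       Skip))"

lemma writes_round [simp]: "writes round_prog = {''i'', ''j'', ''R''}"
  by (auto simp: round_prog_def)

text \<open>Marks are updated in place, so one set early in a round may be propagated further in the
  same round. Hence only two bounds are stated: all successors of the old marks are reached, and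
  nothing outside the closure is.\<close>

lemma runs_round:
  assumes "matrix_store n E s" "marked n ''B'' s = blocked E v" "\<And>i j. E i j \<Longrightarrow> i < n \<and> j < n"
  defines "r \<equiv> steps E v" and "A \<equiv> marked n ''R'' s"
  shows "runs round_prog s (for_time n (for_time n 20))
    (\<lambda>s'. A \<union> r `` A \<subseteq> marked n ''R'' s' \<and> marked n ''R'' s' \<subseteq> r\<^sup>* `` A)"
proof -
  \<comment> \<open>Pairs are visited in lexicographic order. The last conjunct tracks only arcs
    leaving the set \<open>A\<close> marked at the beginning of the round.\<close>
  define I where "I i j s' \<longleftrightarrow> A \<subseteq> marked n ''R'' s' \<and> marked n ''R'' s' \<subseteq> r\<^sup>* `` A \<and>
      (\<forall>a b. a \<in> A \<and> (a, b) \<in> r \<and> (a < i \<or> a = i \<and> b < j) \<longrightarrow> b \<in> marked n ''R'' s')"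
    for i j s'
  have r: "(a, b) \<in> r \<longleftrightarrow> E a b \<and> b \<notin> blocked E v" for a b
    by (simp add: r_def steps_def)
  have indep: "I i j (s'(x := f)) = I i j s'" if "x \<noteq> ''R''" for i j s' x f
    using that by (simp add: I_def)
  \<comment> \<open>Column bound \<open>n\<close> exhausts row \<open>i\<close>, because arcs end
    below \<open>n\<close>.\<close>
  have next_row: "I i n s' \<Longrightarrow> I (Suc i) 0 s'" for i s'
    unfolding I_def using assms(3) by (simp add: less_Suc_eq r) blast
  have "runs round_prog s (for_time n (for_time n 20)) (I n 0)"
    unfolding round_prog_def
  proof (rule runs_For[where I = "\<lambda>i. I i 0"], goal_cases)
    case (3 i s1)
    show ?case
    proof (rule runs_mono[OF runs_For[where I = "I i" and T = 20 and N = n]], goal_cases)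
      case (3 j s2)
      have s2: "s2 ''i'' 0 = i" "s2 ''j'' 0 = j" "matrix_store n E s2"
        "marked n ''B'' s2 = blocked E v"
        using 3 \<open>s1 ''i'' 0 = i\<close> assms(1,2) \<open>\<And>y. _ \<Longrightarrow> _ \<Longrightarrow> s1 y = s y\<close>
        by (simp_all add: matrix_store_def marked_def)
      have ij: "i < n" "j < n" by fact+
      have R: "s2 ''R'' i \<noteq> 0 \<longleftrightarrow> i \<in> marked n ''R'' s2"
        and B: "s2 ''B'' j \<noteq> 0 \<longleftrightarrow> j \<in> blocked E v"
        and e: "val (edge ''i'' ''j'') s2 \<noteq> 0 \<longleftrightarrow> E i j"
        using ij s2(4) val_edge[OF s2(3), of "''i''" "''j''"] s2(1,2) by (auto simp: marked_def)
      have keep: "I i (Suc j) s2" if "\<not> (i \<in> A \<and> (i, j) \<in> r)"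
        using \<open>I i j s2\<close> that unfolding I_def by (auto simp: less_Suc_eq)
      have new: "I i (Suc j) (s2(''R'' := (s2 ''R'')(j := Suc 0)))"
        if "i \<in> marked n ''R'' s2" "(i, j) \<in> r"
      proof -
        have "marked n ''R'' (s2(''R'' := (s2 ''R'')(j := Suc 0))) = insert j (marked n ''R'' s2)"
          using ij by (auto simp: marked_def)
        \<comment> \<open>\<open>i\<close> may have been marked during this round without lying in
          \<open>A\<close>; the upper bound in the invariant still puts it into the closure of
          \<open>A\<close>.\<close>
        moreover have "j \<in> r\<^sup>* `` A"
          using that \<open>I i j s2\<close> unfolding I_def by (meson Image_iff rtrancl.rtrancl_into_rtrancl subsetD)
        ultimately show ?thesis
          using \<open>I i j s2\<close> unfolding I_def by (auto simp: less_Suc_eq)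
      qed
      have sub: "A \<subseteq> marked n ''R'' s2" using \<open>I i j s2\<close> by (simp add: I_def)
      \<comment> \<open>The costs add up to 20: 4 for testing \<open>R\<close>, 8 for
        \<open>edge\<close>, 4 for testing \<open>B\<close> and 4 for the write.\<close>
      have "runs (Cond (Read ''R'' (Var ''i''))
         (Cond (edge ''i'' ''j'')
           (Cond (Read ''B'' (Var ''j'')) Skip (Write ''R'' (Var ''j'') (Num 1)))
           Skip)
         Skip) s2 (1 + cost (Read ''R'' (Var ''i'')) + (1 + cost (edge ''i'' ''j'') +
          (1 + cost (Read ''B'' (Var ''j'')) + 4))) (I i (Suc j))"
        by (intro runs_Cond runs_Skip runs_Write)
           (use s2 R B e keep new sub r in auto)
      then show ?case by simp
    qed (use 3(2,4) in \<open>simp_all add: indep next_row\<close>)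
  qed (use assms(1) in \<open>simp_all add: indep matrix_store_def\<close>, auto simp: I_def A_def)
  then show ?thesis
  proof (rule runs_mono, goal_cases)
    case (2 s')
    have "r `` A \<subseteq> marked n ''R'' s'"
    proof
      fix b assume "b \<in> r `` A"
      then obtain a where "a \<in> A" "(a, b) \<in> r" by blast
      moreover from this have "a < n" using assms(3) r by blast
      ultimately show "b \<in> marked n ''R'' s'" using 2(1) unfolding I_def by blast
    qed
    then show ?case using 2(1) unfolding I_def by blast
  qed simp
qed

text \<open>
  The invariant of the rounds: after \<open>k\<close> of them the marked set is closed or has at least \<open>k\<close>
  elements.
\<close>

lemma saturated_by_card:
  fixes r :: "(nat \<times> nat) set"
  assumes "A \<subseteq> {..<n}" "r `` A \<subseteq> A \<or> k \<le> card A" "n \<le> k" "r \<subseteq> {..<n} \<times> {..<n}"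
  shows "r `` A \<subseteq> A"
  using assms
proof (elim disjE)
  assume "k \<le> card A"
  then have "A = {..<n}"
    using assms(1,3) by (intro card_seteq) auto
  then show ?thesis using assms(4) by auto
qed

text \<open>If \<open>A\<close> is closed, it is its own closure and \<open>A'\<close> equals
  \<open>A\<close>. Otherwise some successor is new and \<open>A'\<close> is strictly
  larger.\<close>

lemma saturate_step:
  fixes r :: "(nat \<times> nat) set"
  assumes "A \<union> r `` A \<subseteq> A'" "A' \<subseteq> r\<^sup>* `` A" "r `` A \<subseteq> A \<or> k \<le> card A" "finite A'"
  shows "r `` A' \<subseteq> A' \<or> Suc k \<le> card A'"
proof (cases "r `` A \<subseteq> A")
  case True
  then have "r\<^sup>* `` A = A" by (rule Image_closed_trancl)
  then show ?thesis using True assms(1,2) by auto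
next
  case False
  then have "A \<subset> A'" using assms(1) by auto
  then show ?thesis using False assms(3,4) psubset_card_mono[of A' A] by auto
qed

definition saturate_prog :: prog where
  "saturate_prog = For ''a'' round_prog"

lemma runs_saturate:
  assumes "matrix_store n E s" "marked n ''B'' s = blocked E v" "\<And>i j. E i j \<Longrightarrow> i < n \<and> j < n"
  defines "r \<equiv> steps E v" and "A \<equiv> marked n ''R'' s"
  shows "runs saturate_prog s (for_time n (for_time n (for_time n 20)))
    (\<lambda>s'. marked n ''R'' s' = r\<^sup>* `` A)"
proof -
  have rn: "r \<subseteq> {..<n} \<times> {..<n}" using assms(3) by (auto simp: r_def steps_def)
  define I where "I k s' \<longleftrightarrow> A \<subseteq> marked n ''R'' s' \<and> marked n ''R'' s' \<subseteq> r\<^sup>* `` A \<and>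
     (r `` marked n ''R'' s' \<subseteq> marked n ''R'' s' \<or> k \<le> card (marked n ''R'' s'))" for k s'
  have "runs saturate_prog s (for_time n (for_time n (for_time n 20))) (I n)"
    unfolding saturate_prog_def
  proof (rule runs_For[where I = I], goal_cases)
    case (3 k s1)
    have s1: "matrix_store n E s1" "marked n ''B'' s1 = blocked E v"
      using 3 assms(1,2) by (simp_all add: matrix_store_def marked_def)
    show ?case
    proof (rule runs_mono[OF runs_round[OF s1 assms(3)]], goal_cases)
      case (3 s2)
      let ?M = "marked n ''R'' s1" and ?M' = "marked n ''R'' s2"
      have step: "?M \<union> r `` ?M \<subseteq> ?M'" "?M' \<subseteq> r\<^sup>* `` ?M"
        using 3 by (simp_all add: r_def)
      have "r\<^sup>* `` ?M \<subseteq> r\<^sup>* `` (r\<^sup>* `` A)"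
        using \<open>I k s1\<close> unfolding I_def by (intro Image_mono) auto
      also have "\<dots> = r\<^sup>* `` A" by (simp add: relcomp_Image[symmetric])
      finally have "?M' \<subseteq> r\<^sup>* `` A" using step by blast
      moreover have "r `` ?M' \<subseteq> ?M' \<or> Suc k \<le> card ?M'"
        using \<open>I k s1\<close> saturate_step[OF step, of k] by (simp add: I_def marked_def)
      ultimately show ?case using step \<open>I k s1\<close> unfolding I_def by blast
    qed simp_all
  qed (use assms(1) in \<open>auto simp: I_def A_def matrix_store_def\<close>)
  then show ?thesis
  proof (rule runs_mono, goal_cases)
    case (2 s')
    let ?M = "marked n ''R'' s'"
    \<comment> \<open>The invariant at \<open>k = n\<close> makes the marks closed; lying between
      \<open>A\<close> and its closure, they equal the closure.\<close>
    have "r `` ?M \<subseteq> ?M"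
      by (rule saturated_by_card[of _ n _ n]) (use 2 rn in \<open>auto simp: I_def marked_def\<close>)
    then have "r\<^sup>* `` ?M = ?M" by (rule Image_closed_trancl)
    then show ?case using 2 unfolding I_def by blast
  qed simp
qed

section \<open>The component belonging to one pair\<close>

definition component_prog :: prog where
  "component_prog = Then block_prog
     (Then (For ''i'' (Write ''R'' (Var ''i'') (Num 0)))
     (Then (Cond (Read ''B'' (Var ''u'')) Skip (Write ''R'' (Var ''u'') (Num 1)))
       saturate_prog))"

lemma writes_component [simp]:
  "writes component_prog = {''i'', ''j'', ''a'', ''R'', ''B''}"
  by (auto simp: component_prog_def block_prog_def saturate_prog_def)

text \<open>Nested like the sequential compositions in \<open>component_prog\<close>, so that
  \<open>runs_Then\<close> matches it without arithmetic.\<close>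

definition component_time :: "'c::comm_semiring_1 \<Rightarrow> 'c" where
  "component_time n = 1 + (1 + for_time n 10 + 4) + (1 + for_time n 4 + (1 + (1 + 3 + 4) +
     for_time n (for_time n (for_time n 20))))"

lemma runs_component:
  assumes "matrix_store n E s" "\<And>i j. E i j \<Longrightarrow> i < n \<and> j < n"
    and "s ''v'' 0 = v" "v < n" "s ''u'' 0 = u" "u < n"
  shows "runs component_prog s (component_time n)
    (\<lambda>s'. marked n ''R'' s' = comp_avoiding E v u)"
  unfolding component_prog_def component_time_def
proof (rule runs_Then[OF runs_block[OF assms(1,3,4)]], goal_cases)
  case (2 s1)
  have s1: "s1 ''u'' 0 = u" "matrix_store n E s1"
    using assms(1,5) 2(2) by (simp_all add: matrix_store_def block_prog_def)
  show ?case
  proof (rule runs_Then)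
    \<comment> \<open>Marks left over from an earlier pair are erased first.\<close>
    show "runs (For ''i'' (Write ''R'' (Var ''i'') (Num 0))) s1 (for_time n 4)
      (\<lambda>s'. \<forall>i<n. s' ''R'' i = 0)"
    proof (rule runs_For[where I = "\<lambda>k s'. \<forall>i<k. s' ''R'' i = 0"], goal_cases)
      case (3 k s')
      then show ?case by (intro runs_Write) (simp_all add: less_Suc_eq)
    qed (use s1 in \<open>simp_all add: matrix_store_def\<close>)
    fix s2
    assume R: "\<forall>i<n. s2 ''R'' i = 0"
      and frame: "\<And>y. y \<notin> writes (For ''i'' (Write ''R'' (Var ''i'') (Num 0))) \<Longrightarrow> s2 y = s1 y"
    have s2: "s2 ''u'' 0 = u" "matrix_store n E s2" "marked n ''B'' s2 = blocked E v"
      using s1 frame 2(1) by (simp_all add: matrix_store_def marked_def)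
    have B: "s2 ''B'' u \<noteq> 0 \<longleftrightarrow> u \<in> blocked E v"
      unfolding s2(3)[symmetric] using assms(6) by (simp add: marked_def)
    \<comment> \<open>A blocked \<open>u\<close> leaves nothing marked, and saturating the empty set
      gives the empty default of \<open>comp_avoiding\<close>.\<close>
    let ?A = "if u \<in> blocked E v then {} else {u}"
    show "runs (Then (Cond (Read ''B'' (Var ''u'')) Skip (Write ''R'' (Var ''u'') (Num 1)))
       saturate_prog) s2
       (1 + (1 + 3 + 4) + for_time n (for_time n (for_time n 20)))
       (\<lambda>s'. marked n ''R'' s' = comp_avoiding E v u)"
    proof (rule runs_Then)
      have "runs (Cond (Read ''B'' (Var ''u'')) Skip (Write ''R'' (Var ''u'') (Num 1))) s2
        (1 + cost (Read ''B'' (Var ''u'')) + 4) (\<lambda>s'. marked n ''R'' s' = ?A)"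
        by (intro runs_Cond runs_Skip runs_Write)
           (use s2(1) B R assms(6) in \<open>auto simp: marked_def\<close>)
      then show "runs (Cond (Read ''B'' (Var ''u'')) Skip (Write ''R'' (Var ''u'') (Num 1))) s2
        (1 + 3 + 4) (\<lambda>s'. marked n ''R'' s' = ?A)" by simp
      fix s3
      assume A: "marked n ''R'' s3 = ?A"
        and frame: "\<And>y. y \<notin> writes (Cond (Read ''B'' (Var ''u'')) Skip
          (Write ''R'' (Var ''u'') (Num 1))) \<Longrightarrow> s3 y = s2 y"
      have s3: "matrix_store n E s3" "marked n ''B'' s3 = blocked E v"
        using s2 frame by (simp_all add: matrix_store_def marked_def)
      show "runs saturate_prog s3 (for_time n (for_time n (for_time n 20)))
        (\<lambda>s'. marked n ''R'' s' = comp_avoiding E v u)"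
        by (rule runs_mono[OF runs_saturate[OF s3 assms(2)]])
           (auto simp: A comp_avoiding_def)
    qed
  qed
qed (use assms(2) in auto)

section \<open>Writing down the boundary of a component\<close>

definition emit_prog :: prog where
  "emit_prog = For ''i'' (For ''j''
     (Cond (Read ''R'' (Var ''i''))
       (Cond (edge ''i'' ''j'')
         (Cond (Read ''R'' (Var ''j'')) Skip
           (Write ''fam'' (Add (Var ''o'') (Var ''j'')) (Num 1)))
         Skip)
       Skip))"

lemma writes_emit [simp]: "writes emit_prog = {''i'', ''j'', ''fam''}"
  by (auto simp: emit_prog_def)

text \<open>\<open>R\<close> is not modified here, so unlike for \<open>round_prog\<close> the
  invariant is an equivalence. Cells of \<open>fam\<close> are only set, never erased;
  \<open>q\<close> is the address where the current characteristic vector begins. The 23 consists of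
  4 + 8 + 4 for the tests and 7 for the write.\<close>

lemma runs_emit:
  assumes "matrix_store n E s" "\<And>i j. E i j \<Longrightarrow> i < n \<and> j < n" "marked n ''R'' s = D"
    and "s ''o'' 0 = q"
  shows "runs emit_prog s (for_time n (for_time n 23))
    (\<lambda>s'. \<forall>m. s' ''fam'' m \<noteq> 0 \<longleftrightarrow> s ''fam'' m \<noteq> 0 \<or> m \<in> (+) q ` boundary E D)"
proof -
  define I where "I i j s' \<longleftrightarrow> (\<forall>m. s' ''fam'' m \<noteq> 0 \<longleftrightarrow> s ''fam'' m \<noteq> 0 \<or>
      (\<exists>a b. m = q + b \<and> a \<in> D \<and> b \<notin> D \<and> E a b \<and> (a < i \<or> a = i \<and> b < j)))"
    for i j and s' :: store
  have indep: "I i j (s'(x := f)) = I i j s'" if "x \<noteq> ''fam''" for i j s' x f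
    using that by (simp add: I_def)
  have next_row: "I i n s' \<Longrightarrow> I (Suc i) 0 s'" for i s'
    unfolding I_def using assms(2) by (simp add: less_Suc_eq) blast
  have "runs emit_prog s (for_time n (for_time n 23)) (I n 0)"
    unfolding emit_prog_def
  proof (rule runs_For[where I = "\<lambda>i. I i 0"], goal_cases)
    case (3 i s1)
    show ?case
    proof (rule runs_mono[OF runs_For[where I = "I i" and T = 23 and N = n]], goal_cases)
      case (3 j s2)
      have s2: "s2 ''i'' 0 = i" "s2 ''j'' 0 = j" "matrix_store n E s2"
        "marked n ''R'' s2 = D" "s2 ''o'' 0 = q"
        using 3 \<open>s1 ''i'' 0 = i\<close> assms(1,3,4) \<open>\<And>y. _ \<Longrightarrow> _ \<Longrightarrow> s1 y = s y\<close>
        by (simp_all add: matrix_store_def marked_def)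
      have ij: "i < n" "j < n" by fact+
      have R: "s2 ''R'' i \<noteq> 0 \<longleftrightarrow> i \<in> D" "s2 ''R'' j \<noteq> 0 \<longleftrightarrow> j \<in> D"
        and e: "val (edge ''i'' ''j'') s2 \<noteq> 0 \<longleftrightarrow> E i j"
        using ij s2(4) val_edge[OF s2(3), of "''i''" "''j''"] s2(1,2) by (auto simp: marked_def)
      have keep: "I i (Suc j) s2" if "\<not> (i \<in> D \<and> j \<notin> D \<and> E i j)"
        using \<open>I i j s2\<close> that unfolding I_def by (auto simp: less_Suc_eq)
      have new: "I i (Suc j) (s2(''fam'' := (s2 ''fam'')(q + j := Suc 0)))"
        if "i \<in> D" "j \<notin> D" "E i j"
        using \<open>I i j s2\<close> that unfolding I_def by (auto simp: less_Suc_eq)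
      have "runs (Cond (Read ''R'' (Var ''i''))
         (Cond (edge ''i'' ''j'')
           (Cond (Read ''R'' (Var ''j'')) Skip
             (Write ''fam'' (Add (Var ''o'') (Var ''j'')) (Num 1)))
           Skip)
         Skip) s2 (1 + cost (Read ''R'' (Var ''i'')) + (1 + cost (edge ''i'' ''j'') +
          (1 + cost (Read ''R'' (Var ''j'')) + 7))) (I i (Suc j))"
        by (intro runs_Cond runs_Skip runs_Write)
           (use s2 R e keep new in auto)
      then show ?case by simp
    qed (use 3(2,4) in \<open>simp_all add: indep next_row\<close>)
  qed (use assms(1) in \<open>simp_all add: indep matrix_store_def\<close>, simp add: I_def)
  then show ?thesis
  proof (rule runs_mono, goal_cases)
    case (2 s')
    have "(\<exists>a b. m = q + b \<and> a \<in> D \<and> b \<notin> D \<and> E a b \<and> (a < n \<or> a = n \<and> b < 0)) \<longleftrightarrow>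
        m \<in> (+) q ` boundary E D" for m
      unfolding boundary_def using assms(2) by fast
    with 2(1) show ?case unfolding I_def by simp
  qed simp
qed

text \<open>Advancing \<open>o\<close> by \<open>n\<close> together with \<open>cnt\<close> keeps
  the address at \<open>cnt * n\<close> without multiplication.\<close>

definition row_prog :: prog where
  "row_prog = Then component_prog (Then emit_prog
     (Then (Write ''o'' (Num 0) (Add (Var ''o'') (Var ''n'')))
       (Write ''cnt'' (Num 0) (Add (Var ''cnt'') (Num 1)))))"

definition row_time :: "'c::comm_semiring_1 \<Rightarrow> 'c" where
  "row_time n = 1 + component_time n + (1 + for_time n (for_time n 23) + (1 + 7 + 6))"

lemma writes_row [simp]:
  "writes row_prog = {''i'', ''j'', ''a'', ''R'', ''B'', ''fam'', ''o'', ''cnt''}"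
  by (auto simp: row_prog_def)

lemma runs_row:
  assumes "matrix_store n E s" "\<And>i j. E i j \<Longrightarrow> i < n \<and> j < n"
    and "s ''v'' 0 = v" "v < n" "s ''u'' 0 = u" "u < n"
  shows "runs row_prog s (row_time n)
    (\<lambda>s'. s' ''cnt'' 0 = Suc (s ''cnt'' 0) \<and> s' ''o'' 0 = s ''o'' 0 + n \<and>
      (\<forall>m. s' ''fam'' m \<noteq> 0 \<longleftrightarrow>
        s ''fam'' m \<noteq> 0 \<or> m \<in> (+) (s ''o'' 0) ` boundary E (comp_avoiding E v u)))"
    (is "runs _ _ _ ?Q")
  unfolding row_prog_def row_time_def
proof (rule runs_Then[OF runs_component[OF assms]], goal_cases)
  case (2 s1)
  have s1: "matrix_store n E s1" "s1 ''o'' 0 = s ''o'' 0" "s1 ''fam'' = s ''fam''"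
    "s1 ''cnt'' = s ''cnt''"
    using 2(2) assms(1) by (simp_all add: matrix_store_def)
  show ?case
  proof (rule runs_Then[OF runs_emit[OF s1(1) assms(2) 2(1) s1(2)]], goal_cases)
    case (2 s2)
    have s2: "s2 ''n'' 0 = n" "s2 ''o'' 0 = s ''o'' 0" "s2 ''cnt'' 0 = s ''cnt'' 0"
      using 2(2) s1 by (simp_all add: matrix_store_def)
    have "runs (Then (Write ''o'' (Num 0) (Add (Var ''o'') (Var ''n'')))
       (Write ''cnt'' (Num 0) (Add (Var ''cnt'') (Num 1)))) s2 (1 + 7 + 6) ?Q"
      by (rule runs_Then[OF runs_Write[where
              Q = "\<lambda>s'. s' = s2(''o'' := (s2 ''o'')(0 := s ''o'' 0 + n))"]])
         (use s2 2(1) s1(3) in \<open>auto intro!: runs_Write\<close>)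
    then show ?case .
  qed (use assms(2) in auto)
qed (use assms(2) in auto)

section \<open>Listing the sets of all pairs\<close>

definition rows_prog :: prog where
  "rows_prog = For ''v'' (For ''u'' row_prog)"

text \<open>Rows are numbered from 0 in the order of the two nested loops,
  \<open>l = v * n + u\<close>.\<close>

abbreviation row_set :: "(nat \<Rightarrow> nat \<Rightarrow> bool) \<Rightarrow> nat \<Rightarrow> nat \<Rightarrow> nat set" where
  "row_set E n l \<equiv> boundary E (comp_avoiding E (l div n) (l mod n))"

lemma runs_rows:
  assumes "matrix_store n E s" "\<And>i j. E i j \<Longrightarrow> i < n \<and> j < n"
    and "s ''cnt'' 0 = 0" "s ''o'' 0 = 0" "\<And>m. s ''fam'' m = 0"
  shows "runs rows_prog s (for_time n (for_time n (row_time n)))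
    (\<lambda>s'. s' ''cnt'' 0 = n * n \<and>
      (\<forall>m. s' ''fam'' m \<noteq> 0 \<longleftrightarrow> (\<exists>l<n * n. m \<in> (+) (l * n) ` row_set E n l)))"
proof -
  \<comment> \<open>Indexing by the number \<open>c\<close> of rows written so far makes the end of
    the inner loop, \<open>v * n + n\<close>, the next index \<open>Suc v * n\<close> of the outer
    one.\<close>
  define J where "J c s' \<longleftrightarrow> s' ''cnt'' 0 = c \<and> s' ''o'' 0 = c * n \<and>
      (\<forall>m. s' ''fam'' m \<noteq> 0 \<longleftrightarrow> (\<exists>l<c. m \<in> (+) (l * n) ` row_set E n l))"
    for c and s' :: store
  have indep: "J c (s'(x := f)) = J c s'" if "x \<noteq> ''cnt''" "x \<noteq> ''o''" "x \<noteq> ''fam''" for c s' x f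
    using that by (simp add: J_def)
  have "runs rows_prog s (for_time n (for_time n (row_time n))) (J (n * n))"
    unfolding rows_prog_def
  proof (rule runs_For[where I = "\<lambda>v. J (v * n)"], goal_cases)
    case (3 v s1)
    have "runs (For ''u'' row_prog) s1 (for_time n (row_time n)) (J (v * n + n))"
    proof (rule runs_For[where I = "\<lambda>u. J (v * n + u)"], goal_cases)
      case (3 u s2)
      have s2: "matrix_store n E s2" "s2 ''v'' 0 = v"
        using 3 \<open>s1 ''v'' 0 = v\<close> assms(1) \<open>\<And>y. _ \<Longrightarrow> _ \<Longrightarrow> s1 y = s y\<close>
        by (simp_all add: matrix_store_def)
      have row: "row_set E n (v * n + u) = boundary E (comp_avoiding E v u)"
        using \<open>u < n\<close> by simp
      have J: "s2 ''cnt'' 0 = v * n + u" "s2 ''o'' 0 = (v * n + u) * n"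
        "\<And>m. s2 ''fam'' m \<noteq> 0 \<longleftrightarrow> (\<exists>l<v * n + u. m \<in> (+) (l * n) ` row_set E n l)"
        using \<open>J (v * n + u) s2\<close> unfolding J_def by blast+
      show ?case
      proof (rule runs_mono[OF runs_row[OF s2(1) assms(2) s2(2) \<open>v < n\<close> \<open>s2 ''u'' 0 = u\<close> \<open>u < n\<close>]],
          goal_cases)
        case (3 s3)
        have "s3 ''fam'' m \<noteq> 0 \<longleftrightarrow> (\<exists>l<Suc (v * n + u). m \<in> (+) (l * n) ` row_set E n l)" for m
        proof -
          have "s3 ''fam'' m \<noteq> 0 \<longleftrightarrow> (\<exists>l<v * n + u. m \<in> (+) (l * n) ` row_set E n l) \<or>
              m \<in> (+) ((v * n + u) * n) ` row_set E n (v * n + u)"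
            using 3(1) J row by metis
          then show ?thesis by (metis less_Suc_eq)
        qed
        then show ?case using 3(1) J(1,2) unfolding J_def by simp
      qed simp_all
    qed (use 3(2,4) in \<open>simp_all add: indep\<close>)
    then show ?case by (simp add: add.commute)
  qed (use assms(1) in \<open>simp_all add: indep matrix_store_def\<close>, simp add: J_def assms(3-5))
  then show ?thesis
    by (rule runs_mono) (simp_all add: J_def)
qed

definition separators_prog :: prog where
  "separators_prog = Then offsets_prog rows_prog"

definition separators_time :: "'c::comm_semiring_1 \<Rightarrow> 'c" where
  "separators_time n = 1 + for_time n 11 + for_time n (for_time n (row_time n))"

text \<open>The bound is built from sums, products and numerals, which evaluation respects; its
  value at the indeterminate \<open>[:0, 1:]\<close> is therefore the polynomial sought.\<close>

lemma poly_separators_time: "poly (separators_time [:0, 1:]) n = separators_time n"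
  by (simp add: separators_time_def row_time_def component_time_def for_time_def)

section \<open>From programs to graphs\<close>

text \<open>The range conditions confine the relation to indices of \<open>vs\<close>, beyond which
  \<open>vs ! i\<close> is unspecified.\<close>

definition edge_index :: "('a,'b) pre_digraph \<Rightarrow> 'a list \<Rightarrow> nat \<Rightarrow> nat \<Rightarrow> bool" where
  "edge_index G vs i j \<longleftrightarrow> i < length vs \<and> j < length vs \<and> vs ! i \<rightarrow>\<^bsub>G\<^esub> vs ! j"

lemma index_less_square:
  fixes i j n :: nat
  assumes "i < n" "j < n"
  shows "i * n + j < n * n"
proof -
  have "i * n + j < Suc i * n" using assms by simp
  also have "\<dots> \<le> n * n" using assms(1) by (intro mult_le_mono1) simp
  finally show ?thesis .
qed

text \<open>The rows occupy disjoint blocks of \<open>n\<close> cells in \<open>fam\<close>, so each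
  characteristic vector can be read back separately.\<close>

lemma runs_separators:
  fixes G :: "('a,'b) pre_digraph" and vs :: "'a list"
  defines "n \<equiv> length vs" and "E \<equiv> edge_index G vs"
  shows "runs separators_prog (graph_input G vs) (separators_time n)
    (\<lambda>s. output_family vs s = (\<lambda>l. (!) vs ` row_set E n l) ` {..<n * n})"
proof -
  let ?s = "graph_input G vs"
  have E: "E i j \<Longrightarrow> i < n \<and> j < n" for i j
    by (simp add: E_def n_def edge_index_def)
  have row: "i < n" if "i \<in> row_set E n l" for i l
    using that E by (auto simp: boundary_def)
  have fam: "output_family vs s = (\<lambda>l. (!) vs ` row_set E n l) ` {..<n * n}"
    if cnt: "s ''cnt'' 0 = n * n"
      and fam: "\<And>m. s ''fam'' m \<noteq> 0 \<longleftrightarrow> (\<exists>l<n * n. m \<in> (+) (l * n) ` row_set E n l)" for s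
  proof -
    have iff: "s ''fam'' (l * n + i) \<noteq> 0 \<longleftrightarrow> i \<in> row_set E n l" if "l < n * n" "i < n" for l i
    proof
      assume "s ''fam'' (l * n + i) \<noteq> 0"
      then obtain l' i' where l': "l * n + i = l' * n + i'" "i' \<in> row_set E n l'"
        unfolding fam by blast
      have "i' < n" using row l'(2) .
      \<comment> \<open>Both column indices are below \<open>n\<close>, so division by
        \<open>n\<close> recovers the row number.\<close>
      have "l = l'" using arg_cong[OF l'(1), of "\<lambda>m. m div n"] \<open>i < n\<close> \<open>i' < n\<close> by simp
      moreover from this have "i = i'" using l'(1) by simp
      ultimately show "i \<in> row_set E n l" using l'(2) by blast
    next
      assume "i \<in> row_set E n l"
      then show "s ''fam'' (l * n + i) \<noteq> 0" unfolding fam using that(1) by blast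
    qed
    have eq: "{vs ! i | i. i < n \<and> s ''fam'' (l * n + i) \<noteq> 0} = (!) vs ` row_set E n l"
      if "l < n * n" for l
      using iff[OF that] row by blast
    have "output_family vs s = {{vs ! i | i. i < n \<and> s ''fam'' (l * n + i) \<noteq> 0} | l. l < n * n}"
      by (simp add: output_family_def Let_def n_def cnt[unfolded n_def])
    also have "\<dots> = (\<lambda>l. {vs ! i | i. i < n \<and> s ''fam'' (l * n + i) \<noteq> 0}) ` {..<n * n}"
      by blast
    also have "\<dots> = (\<lambda>l. (!) vs ` row_set E n l) ` {..<n * n}"
      by (rule image_cong[OF refl]) (simp only: eq lessThan_iff)
    finally show ?thesis .
  qed
  have adj: "?s ''adj'' (i * n + j) \<noteq> 0 \<longleftrightarrow> E i j" if "i < n" "j < n" for i j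
  proof -
    have "(i * n + j) div n = i" "(i * n + j) mod n = j" using that by simp_all
    then show ?thesis
      using that index_less_square[OF that]
      by (simp add: graph_input_def n_def E_def edge_index_def Let_def)
  qed
  show ?thesis
    unfolding separators_prog_def separators_time_def
  proof (rule runs_Then[OF runs_offsets], goal_cases)
    case (3 s)
    \<comment> \<open>Only the counter and the offsets have changed: the adjacency matrix is intact,
      and \<open>cnt\<close>, \<open>o\<close> and \<open>fam\<close> still hold their initial
      zeros.\<close>
    have frame: "s y = ?s y" if "y \<noteq> ''i''" "y \<noteq> ''off''" for y
      using 3(2)[of y] that by (simp add: offsets_prog_def)
    have "matrix_store n E s"
      using 3(1) adj by (simp add: matrix_store_def frame graph_input_def n_def)
    then show ?case
    proof (rule runs_mono[OF runs_rows[OF _ E]], goal_cases)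
      case (6 s')
      then show ?case using fam by blast
    qed (simp_all add: frame graph_input_def)
  qed (simp_all add: graph_input_def n_def)
qed

section \<open>Full components and primitive separators\<close>

lemma full_component_connected:
  assumes "graph G" "D \<in> full_components G S"
  shows "D \<subseteq> verts G - S" "D \<noteq> {}" "neighborhood G D = S"
    and "\<And>x y. x \<in> D \<Longrightarrow> y \<in> D \<Longrightarrow> (x, y) \<in> (arcs_ends G \<inter> D \<times> D)\<^sup>*"
proof -
  interpret graph G by fact
  obtain H where H: "D = verts H" "subgraph H (G \<restriction> (verts G - S))"
    "Digraph_Component.connected H"
    using assms(2) by (auto simp: full_components_def components_def pre_digraph.max_subgraph_def)
  show "neighborhood G D = S" using assms(2) by (simp add: full_components_def)
  show "D \<subseteq> verts G - S" using H(1,2) by (auto simp: subgraph_def)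
  show "D \<noteq> {}" using H(1,3) by (auto simp: connected_def strongly_connected_def)
  have "subgraph H G"
    using H(2) by (meson subgraph_trans induced_imp_subgraph induced_induce Diff_subset)
  then interpret H: wf_digraph H by (simp add: subgraph_def)
  have "arcs_ends H \<subseteq> arcs_ends G"
    using \<open>subgraph H G\<close> by (rule arcs_ends_mono)
  \<comment> \<open>Connectedness of \<open>H\<close> refers to its symmetric closure. As the arcs
    of \<open>G\<close> are symmetric, the arcs of this closure are arcs of \<open>G\<close> between
    vertices of \<open>D\<close>.\<close>
  then have sub: "parcs (mk_symmetric H) \<subseteq> arcs_ends G \<inter> D \<times> D"
    using arcs_ends_symmetric[OF sym_arcs] H(1)
    by (auto simp: parcs_mk_symmetric arcs_ends_conv)
  fix x y assume "x \<in> D" "y \<in> D"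
  then have "x \<rightarrow>\<^sup>*\<^bsub>mk_symmetric H\<^esub> y"
    using H(1,3) by (auto simp: connected_def strongly_connected_def)
  then have "(x, y) \<in> (parcs (mk_symmetric H))\<^sup>*"
    unfolding reachable_def with_proj_simps by (rule rtrancl_on_rtranclI)
  then show "(x, y) \<in> (arcs_ends G \<inter> D \<times> D)\<^sup>*"
    using rtrancl_mono[OF sub] by blast
qed

text \<open>A walk within \<open>D'\<close> from a vertex of \<open>D\<close> could leave
  \<open>D\<close> only into N(D) = S, which \<open>D'\<close> avoids. Used in both directions, this
  makes full components with a common vertex equal.\<close>

lemma full_components_subset:
  assumes "graph G" "D \<in> full_components G S" "D' \<in> full_components G S" "v \<in> D" "v \<in> D'"
  shows "D' \<subseteq> D"
proof
  note D = full_component_connected[OF assms(1,2)] and D' = full_component_connected[OF assms(1,3)]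
  fix y assume "y \<in> D'"
  with assms(5) have "(v, y) \<in> (arcs_ends G \<inter> D' \<times> D')\<^sup>*" by (rule D'(4))
  then show "y \<in> D"
  proof induction
    case base
    show ?case by fact
  next
    case (step y z)
    then have "z \<in> D \<or> z \<in> neighborhood G D"
      using D'(1) by (auto simp: neighborhood_def)
    then show ?case using step D(3) D'(1) by blast
  qed
qed

text \<open>The row sought is \<open>iv * n + iu\<close>, where \<open>iv\<close> is the index of
  \<open>v\<close> and \<open>iu\<close> that of any vertex of a full component avoiding
  \<open>v\<close>.\<close>

lemma primitive_separator_row:
  fixes G :: "('a,'b) pre_digraph"
  assumes "graph G" "set vs = verts G" "primitive_separator G S" "distinct vs"
  defines "n \<equiv> length vs" and "E \<equiv> edge_index G vs"
  obtains l where "l < n * n" "S = (!) vs ` row_set E n l"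
proof -
  interpret graph G by fact
  obtain v D1 D2 where v: "v \<in> verts G" "S \<subseteq> neighborhood G {v}"
    and D12: "D1 \<in> full_components G S" "D2 \<in> full_components G S" "D1 \<noteq> D2"
    using assms(3) unfolding primitive_separator_def minimal_separator_def by blast
  \<comment> \<open>Otherwise \<open>D1\<close> and \<open>D2\<close> share \<open>v\<close> and
    coincide.\<close>
  have "v \<notin> D1 \<or> v \<notin> D2"
    using full_components_subset[OF assms(1)] D12 by blast
  then obtain D where "D \<in> full_components G S" "v \<notin> D"
    using D12 by blast
  note D = full_component_connected[OF assms(1) this(1)]
  have "v \<notin> S" using v(2) by (auto simp: neighborhood_def)
  have sym: "x \<rightarrow>\<^bsub>G\<^esub> y \<Longrightarrow> y \<rightarrow>\<^bsub>G\<^esub> x" for x y using arcs_ends_symmetric[OF sym_arcs] by blast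
  \<comment> \<open>A vertex of \<open>D\<close> adjacent to \<open>v\<close> would put
    \<open>v\<close> into N(D) = S.\<close>
  have away: "\<not> v \<rightarrow>\<^bsub>G\<^esub> w" if "w \<in> D" for w
    using that sym \<open>v \<notin> D\<close> \<open>v \<notin> S\<close> v(1) D(3) by (auto simp: neighborhood_def)
  have index: "\<exists>i<n. vs ! i = x" if "x \<in> verts G" for x
    using that assms(2) by (metis in_set_conv_nth n_def)
  have inV: "vs ! i \<in> verts G" if "i < n" for i
    using that assms(2) nth_mem n_def by metis
  obtain u where "u \<in> D" using D(2) by blast
  obtain iv iu where iv: "iv < n" "vs ! iv = v" and iu: "iu < n" "vs ! iu = u"
    using index v(1) \<open>u \<in> D\<close> D(1) by blast
  have E: "E i j \<longleftrightarrow> i < n \<and> j < n \<and> vs ! i \<rightarrow>\<^bsub>G\<^esub> vs ! j" for i j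
    by (simp add: E_def n_def edge_index_def)
  have unblocked: "i \<notin> blocked E iv" if "vs ! i \<in> D" for i
    using that \<open>v \<notin> D\<close> away iv by (auto simp: blocked_def E)
  have "comp_avoiding E iv iu = (steps E iv)\<^sup>* `` {iu}"
    using unblocked[of iu] iu \<open>u \<in> D\<close> by (simp add: comp_avoiding_def)
  also have "\<dots> = {i. i < n \<and> vs ! i \<in> D}"
  proof (intro equalityI subsetI)
    fix i assume "i \<in> (steps E iv)\<^sup>* `` {iu}"
    then have "(iu, i) \<in> (steps E iv)\<^sup>*" by simp
    then show "i \<in> {i. i < n \<and> vs ! i \<in> D}"
    proof induction
      case base
      show ?case using iu \<open>u \<in> D\<close> by simp
    next
      case (step i j)
      then have ij: "vs ! i \<in> D" "j < n" "vs ! i \<rightarrow>\<^bsub>G\<^esub> vs ! j" "\<not> v \<rightarrow>\<^bsub>G\<^esub> vs ! j"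
        using iv by (auto simp: steps_def E blocked_def)
      then have "vs ! j \<in> D \<or> vs ! j \<in> neighborhood G D"
        using inV by (auto simp: neighborhood_def)
      \<comment> \<open>Otherwise \<open>vs ! j\<close> lies in N(D) = S, hence in N(v), and the
        step would be blocked.\<close>
      then have "vs ! j \<in> D"
        using ij(4) v(2) D(3) by (auto simp: neighborhood_def)
      then show ?case using ij(2) by simp
    qed
  next
    \<comment> \<open>The induction follows a path of vertices inside \<open>D\<close>, all of them
      unblocked, so the claim speaks of every index of \<open>y\<close>. In the base case,
      distinctness of \<open>vs\<close> makes \<open>iu\<close> the only index of
      \<open>u\<close>.\<close>
    have reach: "\<forall>i<n. vs ! i = y \<longrightarrow> (iu, i) \<in> (steps E iv)\<^sup>*" if "y \<in> D" for y
      using D(4)[OF \<open>u \<in> D\<close> that]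
    proof induction
      case base
      show ?case using iu assms(4) by (auto simp: nth_eq_iff_index_eq n_def)
    next
      case (step y z)
      then obtain j where j: "j < n" "vs ! j = y" using index D(1) by blast
      have "(j, i) \<in> steps E iv" if "i < n" "vs ! i = z" for i
        using that j step.hyps(2) unblocked[of i] by (auto simp: steps_def E)
      moreover have "(iu, j) \<in> (steps E iv)\<^sup>*" using step.IH j by blast
      ultimately show ?case by (blast intro: rtrancl_into_rtrancl)
    qed
    fix i assume "i \<in> {i. i < n \<and> vs ! i \<in> D}"
    then show "i \<in> (steps E iv)\<^sup>* `` {iu}" using reach by blast
  qed
  finally have comp: "comp_avoiding E iv iu = {i. i < n \<and> vs ! i \<in> D}" .
  have "S = (!) vs ` boundary E (comp_avoiding E iv iu)"
  proof (intro equalityI subsetI)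
    fix x assume "x \<in> S"
    then obtain w where "x \<in> verts G" "x \<notin> D" "w \<in> D" "w \<rightarrow>\<^bsub>G\<^esub> x"
      using D(3) by (auto simp: neighborhood_def)
    moreover then obtain i j where "i < n" "vs ! i = w" "j < n" "vs ! j = x"
      using index D(1) by (meson DiffD1 subsetD)
    ultimately show "x \<in> (!) vs ` boundary E (comp_avoiding E iv iu)"
      unfolding comp boundary_def by (auto simp: E)
  next
    fix x assume "x \<in> (!) vs ` boundary E (comp_avoiding E iv iu)"
    then show "x \<in> S"
      unfolding D(3)[symmetric] comp by (auto simp: boundary_def E neighborhood_def inV)
  qed
  moreover have "(iv * n + iu) div n = iv" "(iv * n + iu) mod n = iu"
    using iu(1) by simp_all
  ultimately show thesis
    using that[OF index_less_square[OF iv(1) iu(1)]] by metis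
qed

theorem theorem3p1:
  shows "\<exists>(p :: prog) (q :: nat poly). \<forall>(G :: ('a,'b) pre_digraph) vs n.
    graph G \<and> distinct vs \<and> set vs = verts G \<and> n = card (verts G) \<longrightarrow>
    (\<exists>t s \<F>\<^sub>0. exec p (graph_input G vs) t s \<and> t \<le> poly q n \<and> \<F>\<^sub>0 = output_family vs s \<and>
       \<F>\<^sub>0 \<subseteq> Pow (verts G) \<and> card \<F>\<^sub>0 \<le> n\<^sup>2 \<and>
       (\<forall>S. primitive_separator G S \<longrightarrow> S \<in> \<F>\<^sub>0))"
\<comment> \<open>Neither witness depends on the graph; the polynomial is the time bound taken at
  the indeterminate.\<close>
proof (intro exI[of _ separators_prog] exI[of _ "separators_time [:0, 1:]"] allI impI)
  fix G :: "('a,'b) pre_digraph" and vs and n :: nat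
  assume asm: "graph G \<and> distinct vs \<and> set vs = verts G \<and> n = card (verts G)"
  then have n: "n = length vs" by (metis distinct_card)
  let ?E = "edge_index G vs"
  let ?F = "(\<lambda>l. (!) vs ` row_set ?E n l) ` {..<n * n}"
  obtain t s where s: "exec separators_prog (graph_input G vs) t s" "t \<le> separators_time n"
    "output_family vs s = ?F"
    using runs_separators[of G vs] unfolding runs_def n by blast
  have "?F \<subseteq> Pow (verts G)"
  proof -
    have "vs ! i \<in> verts G" if "i \<in> row_set ?E n l" for i l
    proof -
      have "i < length vs" using that unfolding boundary_def edge_index_def by blast
      then show ?thesis using asm nth_mem by metis
    qed
    then show ?thesis by blast
  qed
  moreover have "card ?F \<le> n\<^sup>2"
    using card_image_le[of "{..<n * n}"] by (simp add: power2_eq_square)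
  moreover have "S \<in> ?F" if "primitive_separator G S" for S
    by (rule primitive_separator_row[of G vs S]) (use that asm n in auto)
  ultimately show "\<exists>t s \<F>\<^sub>0. exec separators_prog (graph_input G vs) t s \<and>
      t \<le> poly (separators_time [:0, 1:]) n \<and> \<F>\<^sub>0 = output_family vs s \<and>
      \<F>\<^sub>0 \<subseteq> Pow (verts G) \<and> card \<F>\<^sub>0 \<le> n\<^sup>2 \<and> (\<forall>S. primitive_separator G S \<longrightarrow> S \<in> \<F>\<^sub>0)"
    using s unfolding poly_separators_time by metis
qed

end
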